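(* Let $\rho_1,\rho_2,r_1,r_2$ be parameters, let $I_n(x)=I_n(x;\rho_1,\rho_2,r_1,r_2)$ be the monic complementary Bannai--Ito polynomials, and put $g=\rho_1+\rho_2-r_1-r_2$ and $\omega=4\rho_1-4(r_1+r_2)\rho_1+4r_1r_2-6(r_1+r_2)+5$. Let $$A(x)=\frac{(x+\rho_1+1)(x+\rho_2+1)(2x-2r_1+1)(2x-2r_2+1)}{8(x+1)(2x+1)},$$ $$B(x)=\frac{(x-\rho_2)(x-\rho_1-1)(2x+2r_1-1)(2x+2r_2-1)}{8x(2x-1)},$$ $$C(x)=\frac{(x-\rho_2)(4x^2+\omega)}{8x}-\frac{(x-\rho_2)(x+\rho_1+1)(2x-2r_1+1)(2x-2r_2+1)}{8x(2x+1)}-B(x),$$ $$D(x)=\frac{\rho_2(x+\rho_1+1)(2x-2r_1+1)(2x-2r_2+1)}{8x(x+1)(2x+1)}.$$ Let $h$ be a real parameter and consider the grid $$x_k=(-1)^k(k/2+h+1/4)-1/4,\qquad k\in\mathbb Z.$$ Then the complementary Bannai--Ito polynomials satisfy, for every $n\ge0$ and every $k\in\mathbb Z$ (with $x_k$ not a pole of $A,B,C,D$), the five-term difference equation $$u(x_k)I_n(x_{k+2})+v(x_k)I_n(x_{k+1})+m(x_k)I_n(x_k)+t(x_k)I_n(x_{k-1})+r(x_k)I_n(x_{k-2})=\Lambda_n^{(0)}I_n(x_k),$$ where $$u(x_k)=\begin{cases} A(x_k), & k\text{ even}, \\ B(x_k), & k\text{ odd}, \end{cases}\quad v(x_k)=\begin{cases}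 D(x_k), & k\text{ even}, \\ C(x_k), & k\text{ odd}, \end{cases}$$ $$t(x_k)=\begin{cases} C(x_k), & k\text{ even}, \\ D(x_k), & k\text{ odd}, \end{cases}\quad r(x_k)=\begin{cases} B(x_k), & k\text{ even}, \\ A(x_k), & k\text{ odd}, \end{cases}$$ $m(x_k)=-\big(u(x_k)+v(x_k)+t(x_k)+r(x_k)\big)$, and $\Lambda_{2n}^{(0)}=n^2+(g+1)n$, $\Lambda_{2n+1}^{(0)}=n^2+(g+2)n$.
   Context: Let $g=\rho_1+\rho_2-r_1-r_2$. The monic Bannai--Ito polynomials $B_n(x)$ are defined by $B_{-1}=0$, $B_0=1$ and $$B_{n+1}(x)+(\rho_1-A_n-C_n)B_n(x)+A_{n-1}C_nB_{n-1}(x)=xB_n(x),$$ with $$A_n=\begin{cases}\dfrac{(n+2\rho_1-2r_1+1)(n+2\rho_1-2r_2+1)}{4(n+g+1)},& n\text{ even},\\[2mm] \dfrac{(n+2g+1)(n+2\rho_1+2\rho_2+1)}{4(n+g+1)},& n\text{ odd},\end{cases}$$ $$C_n=\begin{cases}-\dfrac{n(n-2r_1-2r_2)}{4(n+g)},& n\text{ even},\\[2mm] -\dfrac{(n+2\rho_2-2r_2)(n+2\rho_2-2r_1)}{4(n+g)},& n\text{ odd},\end{cases}$$ and $C_0=0$. The complementary Bannai--Ito polynomials are the monic polynomials of degree $n$ defined by $$I_n(x)=\frac{B_{n+1}(x)-A_nB_n(x)}{x-\rho_1}.$$ The parameters are such that the denominators in these recurrence coefficients do not vanish. The functions $A(x),B(x),C(x),D(x)$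 are unrelated to the recurrence coefficients $A_n,C_n$. *)

theory Defs
  imports "HOL-Complex_Analysis.Complex_Analysis"
begin

definition bi_g :: "complex \<Rightarrow> complex \<Rightarrow> complex \<Rightarrow> complex \<Rightarrow> complex" where
  "bi_g \<rho>1 \<rho>2 r1 r2 = \<rho>1 + \<rho>2 - r1 - r2"

definition bi_A :: "complex \<Rightarrow> complex \<Rightarrow> complex \<Rightarrow> complex \<Rightarrow> nat \<Rightarrow> complex" where
  "bi_A \<rho>1 \<rho>2 r1 r2 n =
     (if even n
      then (of_nat n + 2*\<rho>1 - 2*r1 + 1) * (of_nat n + 2*\<rho>1 - 2*r2 + 1)
             / (4 * (of_nat n + bi_g \<rho>1 \<rho>2 r1 r2 + 1))
      else (of_nat n + 2 * bi_g \<rho>1 \<rho>2 r1 r2 + 1) * (of_nat n + 2*\<rho>1 + 2*\<rho>2 + 1)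
             / (4 * (of_nat n + bi_g \<rho>1 \<rho>2 r1 r2 + 1)))"

definition bi_C :: "complex \<Rightarrow> complex \<Rightarrow> complex \<Rightarrow> complex \<Rightarrow> nat \<Rightarrow> complex" where
  "bi_C \<rho>1 \<rho>2 r1 r2 n =
     (if n = 0 then 0
      else if even n
      then - (of_nat n * (of_nat n - 2*r1 - 2*r2)) / (4 * (of_nat n + bi_g \<rho>1 \<rho>2 r1 r2))
      else - ((of_nat n + 2*\<rho>2 - 2*r2) * (of_nat n + 2*\<rho>2 - 2*r1))
             / (4 * (of_nat n + bi_g \<rho>1 \<rho>2 r1 r2)))"

text \<open>
  The three-term recurrence, solved for the polynomial of highest degree. The first step uses
  the convention that the polynomial of index -1 is zero.
\<close>

fun BI :: "complex \<Rightarrow> complex \<Rightarrow> complex \<Rightarrow> complex \<Rightarrow> nat \<Rightarrow> complex poly" where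
  "BI \<rho>1 \<rho>2 r1 r2 0 = 1"
| "BI \<rho>1 \<rho>2 r1 r2 (Suc 0) = [:bi_A \<rho>1 \<rho>2 r1 r2 0 + bi_C \<rho>1 \<rho>2 r1 r2 0 - \<rho>1, 1:]"
| "BI \<rho>1 \<rho>2 r1 r2 (Suc (Suc n)) =
     [:bi_A \<rho>1 \<rho>2 r1 r2 (Suc n) + bi_C \<rho>1 \<rho>2 r1 r2 (Suc n) - \<rho>1, 1:] * BI \<rho>1 \<rho>2 r1 r2 (Suc n)
     - smult (bi_A \<rho>1 \<rho>2 r1 r2 n * bi_C \<rho>1 \<rho>2 r1 r2 (Suc n)) (BI \<rho>1 \<rho>2 r1 r2 n)"

text \<open>The polynomial division is exact: see \<open>CBI_exact\<close> below.\<close>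

definition CBI :: "complex \<Rightarrow> complex \<Rightarrow> complex \<Rightarrow> complex \<Rightarrow> nat \<Rightarrow> complex poly" where
  "CBI \<rho>1 \<rho>2 r1 r2 n =
     (BI \<rho>1 \<rho>2 r1 r2 (Suc n) - smult (bi_A \<rho>1 \<rho>2 r1 r2 n) (BI \<rho>1 \<rho>2 r1 r2 n)) div [:-\<rho>1, 1:]"

lemma BI_Suc_at_rho1:
  "poly (BI \<rho>1 \<rho>2 r1 r2 (Suc n)) \<rho>1 = bi_A \<rho>1 \<rho>2 r1 r2 n * poly (BI \<rho>1 \<rho>2 r1 r2 n) \<rho>1"
proof (induction n)
  case 0
  then show ?case by (simp add: bi_C_def)
next
  case (Suc n)
  then show ?case by (simp add: algebra_simps)
qed

lemma CBI_exact:
  "[:-\<rho>1, 1:] * CBI \<rho>1 \<rho>2 r1 r2 n =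
     BI \<rho>1 \<rho>2 r1 r2 (Suc n) - smult (bi_A \<rho>1 \<rho>2 r1 r2 n) (BI \<rho>1 \<rho>2 r1 r2 n)"
proof -
  have "[:-\<rho>1, 1:] dvd
     BI \<rho>1 \<rho>2 r1 r2 (Suc n) - smult (bi_A \<rho>1 \<rho>2 r1 r2 n) (BI \<rho>1 \<rho>2 r1 r2 n)"
    by (simp only: poly_eq_0_iff_dvd [symmetric] poly_diff poly_smult BI_Suc_at_rho1 diff_self)
  then show ?thesis
    unfolding CBI_def by (rule dvd_mult_div_cancel)
qed

text \<open>
  The coefficients of the difference operator are rational functions: a removable singularity of
  a formula is filled in by \<open>remove_sings\<close>, so that such a point is not a pole and the
  coefficient has its limit as value there (for \<open>\<rho>2 = 0\<close>, for instance, none of the four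
  coefficients has a pole at 0). Where no denominator vanishes the values are those of the
  displayed formulas: see \<open>diff_coeff_eqs\<close> below.
\<close>

definition diff_A :: "complex \<Rightarrow> complex \<Rightarrow> complex \<Rightarrow> complex \<Rightarrow> complex \<Rightarrow> complex" where
  "diff_A \<rho>1 \<rho>2 r1 r2 = remove_sings (\<lambda>x.
     (x + \<rho>1 + 1) * (x + \<rho>2 + 1) * (2*x - 2*r1 + 1) * (2*x - 2*r2 + 1)
       / (8 * (x + 1) * (2*x + 1)))"

definition diff_B :: "complex \<Rightarrow> complex \<Rightarrow> complex \<Rightarrow> complex \<Rightarrow> complex \<Rightarrow> complex" where
  "diff_B \<rho>1 \<rho>2 r1 r2 = remove_sings (\<lambda>x.
     (x - \<rho>2) * (x - \<rho>1 - 1) * (2*x + 2*r1 - 1) * (2*x + 2*r2 - 1)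
       / (8 * x * (2*x - 1)))"

definition bi_omega :: "complex \<Rightarrow> complex \<Rightarrow> complex \<Rightarrow> complex" where
  "bi_omega \<rho>1 r1 r2 = 4*\<rho>1 - 4*(r1 + r2)*\<rho>1 + 4*r1*r2 - 6*(r1 + r2) + 5"

definition diff_C :: "complex \<Rightarrow> complex \<Rightarrow> complex \<Rightarrow> complex \<Rightarrow> complex \<Rightarrow> complex" where
  "diff_C \<rho>1 \<rho>2 r1 r2 = remove_sings (\<lambda>x.
     (x - \<rho>2) * (4*x^2 + bi_omega \<rho>1 r1 r2) / (8 * x)
     - (x - \<rho>2) * (x + \<rho>1 + 1) * (2*x - 2*r1 + 1) * (2*x - 2*r2 + 1) / (8 * x * (2*x + 1))
     - diff_B \<rho>1 \<rho>2 r1 r2 x)"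

definition diff_D :: "complex \<Rightarrow> complex \<Rightarrow> complex \<Rightarrow> complex \<Rightarrow> complex \<Rightarrow> complex" where
  "diff_D \<rho>1 \<rho>2 r1 r2 = remove_sings (\<lambda>x.
     \<rho>2 * (x + \<rho>1 + 1) * (2*x - 2*r1 + 1) * (2*x - 2*r2 + 1)
       / (8 * x * (x + 1) * (2*x + 1)))"

lemma diff_coeff_eqs:
  shows "x + 1 \<noteq> 0 \<Longrightarrow> 2*x + 1 \<noteq> 0 \<Longrightarrow>
      diff_A \<rho>1 \<rho>2 r1 r2 x =
        (x + \<rho>1 + 1) * (x + \<rho>2 + 1) * (2*x - 2*r1 + 1) * (2*x - 2*r2 + 1)
          / (8 * (x + 1) * (2*x + 1))"
    and "x \<noteq> 0 \<Longrightarrow> 2*x - 1 \<noteq> 0 \<Longrightarrow>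
      diff_B \<rho>1 \<rho>2 r1 r2 x =
        (x - \<rho>2) * (x - \<rho>1 - 1) * (2*x + 2*r1 - 1) * (2*x + 2*r2 - 1)
          / (8 * x * (2*x - 1))"
    and "x \<noteq> 0 \<Longrightarrow> 2*x + 1 \<noteq> 0 \<Longrightarrow> 2*x - 1 \<noteq> 0 \<Longrightarrow>
      diff_C \<rho>1 \<rho>2 r1 r2 x =
        (x - \<rho>2) * (4*x^2 + bi_omega \<rho>1 r1 r2) / (8 * x)
        - (x - \<rho>2) * (x + \<rho>1 + 1) * (2*x - 2*r1 + 1) * (2*x - 2*r2 + 1) / (8 * x * (2*x + 1))
        - diff_B \<rho>1 \<rho>2 r1 r2 x"
    and "x \<noteq> 0 \<Longrightarrow> x + 1 \<noteq> 0 \<Longrightarrow> 2*x + 1 \<noteq> 0 \<Longrightarrow>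
      diff_D \<rho>1 \<rho>2 r1 r2 x =
        \<rho>2 * (x + \<rho>1 + 1) * (2*x - 2*r1 + 1) * (2*x - 2*r2 + 1)
          / (8 * x * (x + 1) * (2*x + 1))"
proof -
  show "diff_A \<rho>1 \<rho>2 r1 r2 x =
        (x + \<rho>1 + 1) * (x + \<rho>2 + 1) * (2*x - 2*r1 + 1) * (2*x - 2*r2 + 1)
          / (8 * (x + 1) * (2*x + 1))" if "x + 1 \<noteq> 0" "2*x + 1 \<noteq> 0"
    unfolding diff_A_def
    by (rule remove_sings_at_analytic) (use that in \<open>auto intro!: analytic_intros simp del: distrib_left_numeral\<close>)
  show "diff_B \<rho>1 \<rho>2 r1 r2 x =
        (x - \<rho>2) * (x - \<rho>1 - 1) * (2*x + 2*r1 - 1) * (2*x + 2*r2 - 1)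
          / (8 * x * (2*x - 1))" if "x \<noteq> 0" "2*x - 1 \<noteq> 0"
    unfolding diff_B_def
    by (rule remove_sings_at_analytic) (use that in \<open>auto intro!: analytic_intros simp del: distrib_left_numeral\<close>)
  show "diff_D \<rho>1 \<rho>2 r1 r2 x =
        \<rho>2 * (x + \<rho>1 + 1) * (2*x - 2*r1 + 1) * (2*x - 2*r2 + 1)
          / (8 * x * (x + 1) * (2*x + 1))" if "x \<noteq> 0" "x + 1 \<noteq> 0" "2*x + 1 \<noteq> 0"
    unfolding diff_D_def
    by (rule remove_sings_at_analytic) (use that in \<open>auto intro!: analytic_intros simp del: distrib_left_numeral\<close>)
  show "diff_C \<rho>1 \<rho>2 r1 r2 x =
        (x - \<rho>2) * (4*x^2 + bi_omega \<rho>1 r1 r2) / (8 * x)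
        - (x - \<rho>2) * (x + \<rho>1 + 1) * (2*x - 2*r1 + 1) * (2*x - 2*r2 + 1) / (8 * x * (2*x + 1))
        - diff_B \<rho>1 \<rho>2 r1 r2 x" if "x \<noteq> 0" "2*x + 1 \<noteq> 0" "2*x - 1 \<noteq> 0"
  proof -
    have B: "diff_B \<rho>1 \<rho>2 r1 r2 analytic_on {x}"
      unfolding diff_B_def
      by (rule remove_sings_analytic_on) (use that in \<open>auto intro!: analytic_intros simp del: distrib_left_numeral\<close>)
    show ?thesis
      unfolding diff_C_def
      by (rule remove_sings_at_analytic) (use that B in \<open>auto intro!: analytic_intros simp del: distrib_left_numeral\<close>)
  qed
qed

definition bi_grid :: "real \<Rightarrow> int \<Rightarrow> complex" where
  "bi_grid h k = complex_of_real ((-1) powi k * (of_int k / 2 + h + 1/4) - 1/4)"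

definition diff_u :: "complex \<Rightarrow> complex \<Rightarrow> complex \<Rightarrow> complex \<Rightarrow> real \<Rightarrow> int \<Rightarrow> complex" where
  "diff_u \<rho>1 \<rho>2 r1 r2 h k =
     (if even k then diff_A \<rho>1 \<rho>2 r1 r2 (bi_grid h k) else diff_B \<rho>1 \<rho>2 r1 r2 (bi_grid h k))"

definition diff_v :: "complex \<Rightarrow> complex \<Rightarrow> complex \<Rightarrow> complex \<Rightarrow> real \<Rightarrow> int \<Rightarrow> complex" where
  "diff_v \<rho>1 \<rho>2 r1 r2 h k =
     (if even k then diff_D \<rho>1 \<rho>2 r1 r2 (bi_grid h k) else diff_C \<rho>1 \<rho>2 r1 r2 (bi_grid h k))"

definition diff_t :: "complex \<Rightarrow> complex \<Rightarrow> complex \<Rightarrow> complex \<Rightarrow> real \<Rightarrow> int \<Rightarrow> complex" where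
  "diff_t \<rho>1 \<rho>2 r1 r2 h k =
     (if even k then diff_C \<rho>1 \<rho>2 r1 r2 (bi_grid h k) else diff_D \<rho>1 \<rho>2 r1 r2 (bi_grid h k))"

definition diff_r :: "complex \<Rightarrow> complex \<Rightarrow> complex \<Rightarrow> complex \<Rightarrow> real \<Rightarrow> int \<Rightarrow> complex" where
  "diff_r \<rho>1 \<rho>2 r1 r2 h k =
     (if even k then diff_B \<rho>1 \<rho>2 r1 r2 (bi_grid h k) else diff_A \<rho>1 \<rho>2 r1 r2 (bi_grid h k))"

definition diff_m :: "complex \<Rightarrow> complex \<Rightarrow> complex \<Rightarrow> complex \<Rightarrow> real \<Rightarrow> int \<Rightarrow> complex" where
  "diff_m \<rho>1 \<rho>2 r1 r2 h k =
     - (diff_u \<rho>1 \<rho>2 r1 r2 h k + diff_v \<rho>1 \<rho>2 r1 r2 h k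
        + diff_t \<rho>1 \<rho>2 r1 r2 h k + diff_r \<rho>1 \<rho>2 r1 r2 h k)"

definition bi_Lambda0 :: "complex \<Rightarrow> complex \<Rightarrow> complex \<Rightarrow> complex \<Rightarrow> nat \<Rightarrow> complex" where
  "bi_Lambda0 \<rho>1 \<rho>2 r1 r2 N =
     (let n = of_nat (N div 2); g = bi_g \<rho>1 \<rho>2 r1 r2
      in if even N then n^2 + (g + 1) * n else n^2 + (g + 2) * n)"

end

theory Submission
  imports Defs
begin

text \<open>
  On the grid, the points \<open>x(k\<plusminus>1)\<close> and \<open>x(k\<plusminus>2)\<close> are \<open>- x\<close>, \<open>- x - 1\<close> and \<open>x \<plusminus> 1\<close> for \<open>x = x(k)\<close>. So for
  either parity of \<open>k\<close> the claim is one and the same eigenvalue equation for the operator that sends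
  \<open>f\<close> to
  \<open>A(x) (f(x+1) - f(x)) + B(x) (f(x-1) - f(x)) + C(x) (f(-x) - f(x)) + D(x) (f(-x-1) - f(x))\<close>,
  which holds for every complex \<open>x\<close> that is not a pole (\<open>CBI_difference_equation\<close>).

  Put \<open>a = \<rho>1 + 1\<close>, \<open>b = \<rho>2\<close>, \<open>c = 1/2 - r1\<close>, \<open>d = 1/2 - r2\<close>, \<open>s = a + b + c + d = g + 2\<close>. The
  recurrence of the Bannai--Ito polynomials turns into
  \<open>I(n+1) = (x - (-1)^n b) I(n) - A(n) C(n) I(n-1)\<close> (\<open>CBI_alternating_recurrence\<close>). Two facts about
  its solution follow by induction. The first is a parity: \<open>I(2n)\<close> is even, and \<open>I(2n+1)\<close> is \<open>x - b\<close>
  times an even function. The second, \<open>structure_relation\<close>, is the core of the proof: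
  \<open>(x+a)(x+c)(x+d) (I(n)(-x-1) - I(n)(x))\<close> is \<open>2x+1\<close> times an explicit combination of \<open>I(n)(x)\<close>
  and \<open>I(n+1)(x)\<close>.

  The relation arises as follows. In the variable \<open>x\<^sup>2\<close> the even functions above are Wilson polynomials,
  whose parameter \<open>b\<close> is raised by \<open>1\<close> in the case of \<open>I(2n+1)\<close>. For \<open>I(2n)\<close>, the Wilson
  difference equation for \<open>b\<close> and the action of the difference of the Wilson operators for \<open>b + 1\<close> and \<open>b\<close> both
  involve the two neighbours \<open>x \<plusminus> 1\<close>; eliminating \<open>x - 1\<close> leaves a first-order relation, and odd indices
  behave in the same way. Being of first order, the relation needs no companion in the induction: it is a 2 by 2 linear system in the shift
  that is compatible with the recurrence in \<open>n\<close>.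

  Used at \<open>x\<close> and at \<open>- x\<close>, together with parity, the structure relation expresses all values in the
  difference equation by \<open>I(n)(x)\<close> and \<open>I(n+1)(x)\<close>. The latter cancels, and the coefficient of the
  former is the eigenvalue. This argument divides by \<open>x\<close>, \<open>x + 1\<close> and \<open>2x \<plusminus> 1\<close>; removable singularities
  of the coefficients at the excluded points are handled by continuity.
\<close>

section \<open>The recurrence of the complementary Bannai--Ito polynomials\<close>

text \<open>
  This inverts the defining transform: moving one factor of the three-term recurrence to each side,
  \<open>(x - \<rho>1) B(n+1)\<close> is the difference of \<open>B(n+2) - A(n+1) B(n+1)\<close> and \<open>C(n+1)\<close> times
  \<open>B(n+1) - A(n) B(n)\<close>, and both of these are \<open>x - \<rho>1\<close> times a complementary polynomial.
\<close>

lemma BI_Suc_eq_CBI: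
  "BI \<rho>1 \<rho>2 r1 r2 (Suc n) = CBI \<rho>1 \<rho>2 r1 r2 (Suc n) - smult (bi_C \<rho>1 \<rho>2 r1 r2 (Suc n)) (CBI \<rho>1 \<rho>2 r1 r2 n)"
proof -
  have "[:-\<rho>1, 1:] * BI \<rho>1 \<rho>2 r1 r2 (Suc n) =
        [:-\<rho>1, 1:] * (CBI \<rho>1 \<rho>2 r1 r2 (Suc n) - smult (bi_C \<rho>1 \<rho>2 r1 r2 (Suc n)) (CBI \<rho>1 \<rho>2 r1 r2 n))"
    unfolding right_diff_distrib mult_smult_right CBI_exact
    by (simp add: poly_eq_poly_eq_iff [symmetric] fun_eq_iff algebra_simps)
  thus ?thesis by (subst (asm) mult_cancel_left) auto
qed

lemma CBI_0: "CBI \<rho>1 \<rho>2 r1 r2 0 = 1"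
proof -
  have "[:-\<rho>1, 1:] * CBI \<rho>1 \<rho>2 r1 r2 0 = [:-\<rho>1, 1:] * 1"
    unfolding CBI_exact by (simp add: bi_C_def)
  thus ?thesis by (subst (asm) mult_cancel_left) auto
qed

lemma poly_CBI_1:
  "poly (CBI \<rho>1 \<rho>2 r1 r2 (Suc 0)) x = x - \<rho>1 + (bi_A \<rho>1 \<rho>2 r1 r2 0 + bi_C \<rho>1 \<rho>2 r1 r2 (Suc 0))"
proof -
  have "poly (BI \<rho>1 \<rho>2 r1 r2 (Suc 0)) x = poly (CBI \<rho>1 \<rho>2 r1 r2 (Suc 0)) x - bi_C \<rho>1 \<rho>2 r1 r2 (Suc 0)"
    unfolding BI_Suc_eq_CBI by (simp add: CBI_0)
  thus ?thesis by (simp add: bi_C_def algebra_simps)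
qed

lemma poly_CBI_rec:
  "poly (CBI \<rho>1 \<rho>2 r1 r2 (Suc (Suc n))) x =
     (x - \<rho>1 + (bi_A \<rho>1 \<rho>2 r1 r2 (Suc n) + bi_C \<rho>1 \<rho>2 r1 r2 (Suc (Suc n)))) * poly (CBI \<rho>1 \<rho>2 r1 r2 (Suc n)) x
     - bi_A \<rho>1 \<rho>2 r1 r2 (Suc n) * bi_C \<rho>1 \<rho>2 r1 r2 (Suc n) * poly (CBI \<rho>1 \<rho>2 r1 r2 n) x"
proof -
  have "poly ([:-\<rho>1, 1:] * CBI \<rho>1 \<rho>2 r1 r2 (Suc n)) x =
        poly (BI \<rho>1 \<rho>2 r1 r2 (Suc (Suc n)) - smult (bi_A \<rho>1 \<rho>2 r1 r2 (Suc n)) (BI \<rho>1 \<rho>2 r1 r2 (Suc n))) x"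
    unfolding CBI_exact ..
  thus ?thesis
    unfolding BI_Suc_eq_CBI[of _ _ _ _ n] BI_Suc_eq_CBI[of _ _ _ _ "Suc n"]
    by (simp add: algebra_simps)
qed

text \<open>
  The parameters \<open>a\<close>, \<open>b = \<rho>2\<close>, \<open>c\<close>, \<open>d\<close> are those of the Wilson polynomials behind the sequence; in them
  a symmetry in \<open>a, c, d\<close> appears that the original ones hide. With the denominators cleared, the
  later identities are polynomial.
\<close>

lemma bi_coeffs_factored:
  fixes n :: nat
  assumes nz: "\<And>j::nat. of_nat j + bi_g \<rho>1 b r1 r2 + 1 \<noteq> 0"
    and a: "a = \<rho>1 + 1" and c: "c = 1/2 - r1" and d: "d = 1/2 - r2" and s: "s = a + b + c + d"
  defines "N \<equiv> of_nat n"
  shows "bi_A \<rho>1 b r1 r2 (2*n) * (2*N+s-1) = (N+a+c-1) * (N+a+d-1)"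
    and "bi_A \<rho>1 b r1 r2 (Suc (2*n)) * (2*N+s) = (N+s-1) * (N+a+b)"
    and "bi_C \<rho>1 b r1 r2 (Suc (2*n)) * (2*N+s-1) = - ((N+b+c) * (N+b+d))"
    and "bi_C \<rho>1 b r1 r2 (Suc (Suc (2*n))) * (2*N+s) = - ((N+1) * (N+c+d))"
proof -
  have g: "bi_g \<rho>1 b r1 r2 = s - 2"
    by (simp add: s a c d bi_g_def)
  have nz: "2*N + s \<noteq> 0" "2*N + s - 1 \<noteq> 0"
    using nz[of "2*n"] nz[of "2*n+1"] by (simp_all add: g N_def algebra_simps)
  \<comment> \<open>Unless numerals are kept from distributing, the common factors are not recognized.\<close>
  have "bi_A \<rho>1 b r1 r2 (2*n) = (2*(N+a+c-1)) * (2*(N+a+d-1)) / (4*(2*N+s-1))"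
    unfolding bi_A_def g by (simp add: N_def a c d algebra_simps)
  thus "bi_A \<rho>1 b r1 r2 (2*n) * (2*N+s-1) = (N+a+c-1) * (N+a+d-1)"
    using nz by (simp del: distrib_left_numeral right_diff_distrib_numeral)
  have "bi_A \<rho>1 b r1 r2 (Suc (2*n)) = (2*(N+s-1)) * (2*(N+a+b)) / (4*(2*N+s))"
    unfolding bi_A_def g by (simp add: N_def a algebra_simps)
  thus "bi_A \<rho>1 b r1 r2 (Suc (2*n)) * (2*N+s) = (N+s-1) * (N+a+b)"
    using nz by (simp del: distrib_left_numeral right_diff_distrib_numeral)
  have "bi_C \<rho>1 b r1 r2 (Suc (2*n)) = - ((2*(N+b+c)) * (2*(N+b+d))) / (4*(2*N+s-1))"
    unfolding bi_C_def g by (simp add: N_def c d algebra_simps)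
  thus "bi_C \<rho>1 b r1 r2 (Suc (2*n)) * (2*N+s-1) = - ((N+b+c) * (N+b+d))"
    using nz by (simp del: distrib_left_numeral right_diff_distrib_numeral)
  have "bi_C \<rho>1 b r1 r2 (Suc (Suc (2*n))) = - ((2*(N+1)) * (2*(N+c+d))) / (4*(2*N+s))"
    unfolding bi_C_def g by (simp add: N_def c d algebra_simps)
  thus "bi_C \<rho>1 b r1 r2 (Suc (Suc (2*n))) * (2*N+s) = - ((N+1) * (N+c+d))"
    using nz by (simp del: distrib_left_numeral right_diff_distrib_numeral)
qed

text \<open>
  The even members of such a sequence are, as functions of \<open>x\<^sup>2\<close>, monic Wilson polynomials with
  parameters \<open>a, b, c, d\<close>; the odd ones are \<open>x - b\<close> times Wilson polynomials with \<open>b + 1\<close> in place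
  of \<open>b\<close>. Both coefficient formulas are symmetric in \<open>a, c, d\<close>.
\<close>

locale alternating_recurrence =
  fixes a b c d s :: complex and t :: "nat \<Rightarrow> complex" and f :: "nat \<Rightarrow> complex \<Rightarrow> complex"
  assumes s: "s = a + b + c + d"
    and nz: "\<And>j::nat. of_nat j + s - 1 \<noteq> 0"
    and f_0: "f 0 x = 1"
    and f_1: "f (Suc 0) x = x - b"
    and f_even: "f (Suc (Suc (2*n))) x = (x+b) * f (Suc (2*n)) x - t (Suc (2*n)) * f (2*n) x"
    and f_odd: "f (Suc (Suc (Suc (2*n)))) x =
      (x-b) * f (Suc (Suc (2*n))) x - t (Suc (Suc (2*n))) * f (Suc (2*n)) x"
    and t_odd: "t (Suc (2*n)) * (2 * of_nat n+s-1) * (2 * of_nat n+s) =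
      - (of_nat n+s-1) * (of_nat n+a+b) * (of_nat n+b+c) * (of_nat n+b+d)"
    and t_even: "t (Suc (Suc (2*n))) * (2 * of_nat n+s+1) * (2 * of_nat n+s) =
      - (of_nat n+1) * (of_nat n+a+c) * (of_nat n+a+d) * (of_nat n+c+d)"

lemma CBI_alternating_recurrence:
  assumes g: "\<And>j::nat. of_nat j + bi_g \<rho>1 b r1 r2 + 1 \<noteq> 0"
    and a: "a = \<rho>1 + 1" and c: "c = 1/2 - r1" and d: "d = 1/2 - r2" and s: "s = a + b + c + d"
  shows "alternating_recurrence a b c d s
           (\<lambda>n. bi_A \<rho>1 b r1 r2 n * bi_C \<rho>1 b r1 r2 n) (\<lambda>n. poly (CBI \<rho>1 b r1 r2 n))"
proof
  show "s = a + b + c + d" by (rule s)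
  have bi_g: "bi_g \<rho>1 b r1 r2 = s - 2" by (simp add: bi_g_def s a c d)
  show nz: "of_nat j + s - 1 \<noteq> 0" for j
    using g[of j] by (simp add: bi_g algebra_simps)
  note W = bi_coeffs_factored[OF g a c d s]
  have even_sum: "bi_A \<rho>1 b r1 r2 (2*m) + bi_C \<rho>1 b r1 r2 (Suc (2*m)) = \<rho>1 - b" for m
  proof -
    have "(2 * of_nat m+s-1) * (bi_A \<rho>1 b r1 r2 (2*m) + bi_C \<rho>1 b r1 r2 (Suc (2*m)))
        = (2 * of_nat m+s-1) * (\<rho>1 - b)"
      using W(1,3)[of m] a s by algebra
    thus ?thesis using nz[of "2*m"] unfolding mult_cancel_left by simp
  qed
  fix n :: nat and x :: complex
  let ?N = "of_nat n :: complex"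
  have odd_sum: "bi_A \<rho>1 b r1 r2 (Suc (2*n)) + bi_C \<rho>1 b r1 r2 (Suc (Suc (2*n))) = \<rho>1 + b"
  proof -
    have "(2*?N+s) * (bi_A \<rho>1 b r1 r2 (Suc (2*n)) + bi_C \<rho>1 b r1 r2 (Suc (Suc (2*n))))
        = (2*?N+s) * (\<rho>1 + b)"
      using W(2,4)[of n] a s by algebra
    moreover have "2*?N+s \<noteq> 0" using nz[of "2*n+1"] by simp
    ultimately show ?thesis unfolding mult_cancel_left by simp
  qed
  show "poly (CBI \<rho>1 b r1 r2 0) x = 1"
    by (simp add: CBI_0)
  show "poly (CBI \<rho>1 b r1 r2 (Suc 0)) x = x - b"
    using even_sum[of 0] by (simp add: poly_CBI_1)
  show "poly (CBI \<rho>1 b r1 r2 (Suc (Suc (2*n)))) x = (x+b) * poly (CBI \<rho>1 b r1 r2 (Suc (2*n))) x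
      - bi_A \<rho>1 b r1 r2 (Suc (2*n)) * bi_C \<rho>1 b r1 r2 (Suc (2*n)) * poly (CBI \<rho>1 b r1 r2 (2*n)) x"
    unfolding poly_CBI_rec odd_sum by simp
  show "poly (CBI \<rho>1 b r1 r2 (Suc (Suc (Suc (2*n))))) x = (x-b) * poly (CBI \<rho>1 b r1 r2 (Suc (Suc (2*n)))) x
      - bi_A \<rho>1 b r1 r2 (Suc (Suc (2*n))) * bi_C \<rho>1 b r1 r2 (Suc (Suc (2*n))) * poly (CBI \<rho>1 b r1 r2 (Suc (2*n))) x"
    using even_sum[of "Suc n"] unfolding poly_CBI_rec[of _ _ _ _ "Suc (2*n)"] by simp
  show "bi_A \<rho>1 b r1 r2 (Suc (2*n)) * bi_C \<rho>1 b r1 r2 (Suc (2*n)) * (2*?N+s-1) * (2*?N+s) =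
      - (?N+s-1) * (?N+a+b) * (?N+b+c) * (?N+b+d)"
    using W(2,3)[of n] by algebra
  have "bi_A \<rho>1 b r1 r2 (Suc (Suc (2*n))) * (2*?N+s+1) = (?N+a+c) * (?N+a+d)"
    using W(1)[of "Suc n"] by (simp add: algebra_simps)
  thus "bi_A \<rho>1 b r1 r2 (Suc (Suc (2*n))) * bi_C \<rho>1 b r1 r2 (Suc (Suc (2*n))) * (2*?N+s+1) * (2*?N+s) =
      - (?N+1) * (?N+a+c) * (?N+a+d) * (?N+c+d)"
    using W(4)[of n] by algebra
qed

section \<open>A first-order structure relation\<close>

text \<open>
  One induction step, for a fixed \<open>x\<close>: \<open>P, Q, N, M\<close> are four consecutive members of the sequence at
  \<open>x\<close>, and primes mark their values at \<open>- x - 1\<close>. After the recurrence has eliminated \<open>N\<close> and \<open>M\<close>,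
  the coefficients of \<open>P\<close> agree identically. Those of \<open>Q\<close> involve \<open>t\<close> and \<open>t'\<close> only
  through \<open>t (2n+s-1)\<close> and \<open>t' (2n+s+1)\<close>, so that the common denominator \<open>2n+s\<close> is all that has to
  be cleared.
\<close>

lemma structure_step_even:
  fixes x::complex
  assumes "z = (x+a)*(x+c)*(x+d)"
  and s: "s = a+b+c+d"
  and "z*(P' - P) = (2*x+1)*((n+s-1)*(n+b-x)*P + (2*n+s-1)*Q)"
  and "z*(Q' - Q) = -(2*x+1)*((x^2+a*c+a*d+c*d - n*(x+b) + n*(n+s))*Q + (2*n+s)*N)"
  and "N = (x+b)*Q - t*P" "N' = (-x-1+b)*Q' - t*P'" "M = (x-b)*N - t'*Q"
  and "t*(2*n+s-1)*(2*n+s) = - (n+s-1)*(n+a+b)*(n+b+c)*(n+b+d)"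
  and "t'*(2*n+s+1)*(2*n+s) = - (n+1)*(n+a+c)*(n+a+d)*(n+c+d)"
  and nz: "2*n+s \<noteq> 0"
  shows "z*(N' - N) = (2*x+1)*((n+s)*(n+1+b-x)*N + (2*n+s+1)*M)"
proof -
  have "(2*n+s)*(z*(N' - N)) = (2*n+s)*((2*x+1)*((n+s)*(n+1+b-x)*N + (2*n+s+1)*M))"
    using assms(1,3-9) unfolding s by algebra
  thus ?thesis using nz by simp
qed

text \<open>
  As before, but starting at an odd index; now \<open>2n+s+1\<close> is the common denominator of \<open>t (2n+s)\<close> and
  \<open>t' (2n+s+2)\<close>.
\<close>

lemma structure_step_odd:
  fixes x::complex
  assumes "z = (x+a)*(x+c)*(x+d)"
  and s: "s = a+b+c+d"
  and "z*(P' - P) = -(2*x+1)*((x^2+a*c+a*d+c*d - n*(x+b) + n*(n+s))*P + (2*n+s)*Q)"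
  and "z*(Q' - Q) = (2*x+1)*((n+s)*(n+1+b-x)*Q + (2*n+s+1)*N)"
  and "N = (x-b)*Q - t*P" "N' = (-x-1-b)*Q' - t*P'" "M = (x+b)*N - t'*Q"
  and "t*(2*n+s+1)*(2*n+s) = - (n+1)*(n+a+c)*(n+a+d)*(n+c+d)"
  and "t'*(2*n+s+1)*(2*n+s+2) = - (n+s)*(n+1+a+b)*(n+1+b+c)*(n+1+b+d)"
  and nz: "2*n+s+1 \<noteq> 0"
  shows "z*(N' - N) = -(2*x+1)*((x^2+a*c+a*d+c*d - (n+1)*(x+b) + (n+1)*(n+1+s))*N + (2*n+s+2)*M)"
proof -
  have "(2*n+s+1)*(z*(N' - N)) = (2*n+s+1)*(-(2*x+1)*((x^2+a*c+a*d+c*d - (n+1)*(x+b) + (n+1)*(n+1+s))*N + (2*n+s+2)*M))"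
    using assms(1,3-9) unfolding s by algebra
  thus ?thesis using nz by simp
qed

context alternating_recurrence
begin

lemma parity:
  "f (2*n) (-x) = f (2*n) x"
  "(x-b) * f (Suc (2*n)) (-x) = -(x+b) * f (Suc (2*n)) x"
proof (induction n)
  case 0
  {
    case 1
    show ?case by (simp add: f_0)
  next
    case 2
    show ?case by (simp add: f_1 algebra_simps)
  }
next
  case (Suc n)
  have ev: "f (2 * Suc n) (-x) = f (2 * Suc n) x"
  proof -
    have "(-x+b) * f (Suc (2*n)) (-x) = (x+b) * f (Suc (2*n)) x"
      using arg_cong[OF Suc(2), of uminus] by (simp add: algebra_simps)
    thus ?thesis using Suc(1) f_even[of n x] f_even[of n "-x"] by simp
  qed
  {
    case 1
    show ?case by (rule ev)
  next
    case 2
    have "(x-b) * f (Suc (Suc (Suc (2*n)))) (-x)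
        = (x-b) * (-x-b) * f (Suc (Suc (2*n))) x - t (Suc (Suc (2*n))) * ((x-b) * f (Suc (2*n)) (-x))"
      using ev unfolding f_odd[of n "-x"] by (simp add: algebra_simps)
    also have "\<dots> = -(x+b) * ((x-b) * f (Suc (Suc (2*n))) x - t (Suc (Suc (2*n))) * f (Suc (2*n)) x)"
      unfolding Suc(2) by algebra
    finally show ?case by (simp add: f_odd)
  }
qed

text \<open>
  The reflection \<open>x \<mapsto> - x - 1\<close> maps each member to a combination of itself and its successor, with
  coefficients that are rational in \<open>x\<close>, of degrees that do not grow with the index. Unlike the difference equation, this
  relation is of first order, so that the recurrence carries it from one index to the next.
\<close>

lemma structure_relation:
  defines "z \<equiv> (\<lambda>x. (x+a)*(x+c)*(x+d))"
  shows "z x * (f (2*n) (-x-1) - f (2*n) x) = (2*x+1) *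
           ((of_nat n+s-1)*(of_nat n+b-x) * f (2*n) x + (2 * of_nat n+s-1) * f (Suc (2*n)) x)"
    and "z x * (f (Suc (2*n)) (-x-1) - f (Suc (2*n)) x) = -(2*x+1) *
           ((x^2+a*c+a*d+c*d - of_nat n*(x+b) + of_nat n*(of_nat n+s)) * f (Suc (2*n)) x
            + (2 * of_nat n+s) * f (Suc (Suc (2*n))) x)"
proof (induction n)
  case 0
  \<comment> \<open>The factor \<open>n + s - 1\<close> of \<open>t (2n+1)\<close> cancels against \<open>2n + s - 1\<close> for \<open>n = 0\<close>.\<close>
  have "(s-1) * (t (Suc 0) * s) = (s-1) * (- ((a+b)*(b+c)*(b+d)))"
    using t_odd[of 0] by (simp add: algebra_simps)
  hence t: "t (Suc 0) * s = - ((a+b)*(b+c)*(b+d))"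
    using nz[of 0] unfolding mult_cancel_left by simp
  have N: "f (Suc (Suc 0)) x = (x+b) * (x-b) - t (Suc 0)"
    using f_even[of 0 x] by (simp add: f_0 f_1)
  {
    case 1
    show ?case by (simp add: f_0 f_1 algebra_simps)
  next
    case 2
    have "(x+a)*(x+c)*(x+d)*((-x-1-b)-(x-b)) =
        -(2*x+1) * ((x^2+a*c+a*d+c*d)*(x-b) + s*((x+b)*(x-b) - t (Suc 0)))"
      using t s by algebra
    thus ?case by (simp add: f_1 N z_def)
  }
next
  case (Suc n)
  let ?n = "of_nat n :: complex"
  have nz': "2*?n + s \<noteq> 0" "2*?n + s + 1 \<noteq> 0"
    using nz[of "2*n+1"] nz[of "2*n+2"] by (simp_all add: algebra_simps)
  have ev: "z x * (f (Suc (Suc (2*n))) (-x-1) - f (Suc (Suc (2*n))) x) = (2*x+1) *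
      ((?n+s)*(?n+1+b-x) * f (Suc (Suc (2*n))) x + (2*?n+s+1) * f (Suc (Suc (Suc (2*n)))) x)"
    by (rule structure_step_even[OF _ s Suc f_even f_even f_odd t_odd t_even nz'(1)]) (simp add: z_def)
  {
    case 1
    show ?case using ev by (simp add: algebra_simps)
  next
    case 2
    have "z x * (f (Suc (Suc (Suc (2*n)))) (-x-1) - f (Suc (Suc (Suc (2*n)))) x) = -(2*x+1) *
      ((x^2+a*c+a*d+c*d - (?n+1)*(x+b) + (?n+1)*(?n+1+s)) * f (Suc (Suc (Suc (2*n)))) x
       + (2*?n+s+2) * f (Suc (Suc (Suc (Suc (2*n))))) x)"
      by (rule structure_step_odd[OF _ s Suc(2) ev f_odd f_odd _ t_even _ nz'(2), where t' = "t (Suc (2*Suc n))"])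
         (use f_even[of "Suc n" x] t_odd[of "Suc n"] in \<open>simp_all add: z_def add_ac\<close>)
    thus ?case by (simp add: algebra_simps)
  }
qed

end

section \<open>From the structure relation to the difference equation\<close>

text \<open>
  Here \<open>P, Y, W\<close> are the values of an even member at \<open>x\<close>, \<open>- x - 1\<close> and \<open>x - 1\<close>; by parity \<open>Y\<close> and \<open>W\<close>
  are also its values at \<open>x + 1\<close> and \<open>1 - x\<close>, and the term with coefficient \<open>C\<close> disappears. The structure
  relation at \<open>x\<close> and at \<open>- x\<close> expresses \<open>Y\<close> and \<open>W\<close> by \<open>P\<close> and the next member \<open>Q\<close>, which cancels.
\<close>

lemma difference_equation_even:
  fixes x :: complex
  assumes S1: "z*(Y - P) = (2*x+1)*((n+s-1)*(n+b-x)*P + (2*n+s-1)*Q)"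
    and S2: "z'*(W - P) = (2*(-x)+1)*((n+s-1)*(n+b-(-x))*P + (2*n+s-1)*Q')"
    and par: "(x-b)*Q' = -(x+b)*Q"
    and A: "2*(x+1)*(2*x+1)*A = z*(x+b+1)"
    and D: "2*x*(x+1)*(2*x+1)*D = z*b"
    and B: "2*x*(2*x-1)*B = -(x-b)*z'"
    and nz: "x \<noteq> 0" "x+1 \<noteq> 0" "2*x+1 \<noteq> 0" "2*x-1 \<noteq> 0"
  shows "A*(Y-P) + D*(Y-P) + B*(W-P) = n*(n+s-1)*P"
proof -
  have "2*x*(x+1)*(2*x+1)*(A+D) = z*(x+1)*(x+b)"
    using A D by algebra
  hence "2*x*(2*x+1)*(A+D) = z*(x+b)" using nz by algebra
  hence "2*x*(2*x+1)*((A+D)*(Y-P)) = (x+b)*(2*x+1)*((n+s-1)*(n+b-x)*P + (2*n+s-1)*Q)"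
    using S1 by algebra
  hence 1: "2*x*((A+D)*(Y-P)) = (x+b)*((n+s-1)*(n+b-x)*P + (2*n+s-1)*Q)"
    using nz by algebra
  have "2*x*(2*x-1)*(B*(W-P)) = (2*x-1)*(x-b)*((n+s-1)*(n+b-(-x))*P + (2*n+s-1)*Q')"
    using B S2 by algebra
  hence 2: "2*x*(B*(W-P)) = (x-b)*((n+s-1)*(n+b-(-x))*P + (2*n+s-1)*Q')"
    using nz by algebra
  have "2*x*((A+D)*(Y-P) + B*(W-P)) = 2*x*(n*(n+s-1)*P)"
    using 1 2 par by algebra
  thus ?thesis using nz by (simp add: distrib_right)
qed

text \<open>
  For an odd member with value \<open>P\<close> at \<open>x\<close>, the values at \<open>- x\<close>, \<open>- x - 1\<close>, \<open>x + 1\<close>, \<open>x - 1\<close> are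
  \<open>V, Y, X, W\<close>. Parity now ties \<open>V\<close> to \<open>P\<close> and \<open>X\<close> to \<open>Y\<close> by factors that are not \<open>1\<close>; it is stated
  without division, since \<open>x = b\<close> and \<open>x = b - 1\<close> are not excluded. The factors \<open>x - b\<close> of \<open>B\<close> and \<open>C\<close>
  and \<open>x + b + 1\<close> of \<open>A\<close> compensate for this.
\<close>

lemma difference_equation_odd:
  fixes x :: complex
  assumes S1: "z*(Y - P) = -(2*x+1)*((x^2+a*c+a*d+c*d - n*(x+b) + n*(n+s))*P + (2*n+s)*N)"
    and S2: "z'*(W - V) = -(2*(-x)+1)*(((-x)^2+a*c+a*d+c*d - n*(-x+b) + n*(n+s))*V + (2*n+s)*N)"
    and pV: "(x-b)*V = -(x+b)*P"
    and pX: "(x+1-b)*Y = -(x+1+b)*X"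
    and A: "2*(x+1)*(2*x+1)*A = z*(x+b+1)"
    and D: "2*x*(x+1)*(2*x+1)*D = z*b"
    and B: "2*x*(2*x-1)*B = -(x-b)*z'"
    and C: "2*x*(2*x+1)*(C+B) = (x-b)*(2*x+1)*(x^2+a*c+a*d+c*d) - (x-b)*z"
    and nz: "x \<noteq> 0" "x+1 \<noteq> 0" "2*x+1 \<noteq> 0" "2*x-1 \<noteq> 0"
  shows "A*(X-P) + D*(Y-P) + C*(V-P) + B*(W-P) = n*(n+s)*P"
proof -
  define R where "R = (x^2+a*c+a*d+c*d - n*(x+b) + n*(n+s))*P + (2*n+s)*N"
  define R' where "R' = (x^2+a*c+a*d+c*d - n*(-x+b) + n*(n+s))*V + (2*n+s)*N"
  have "2*x*(2*x-1)*(B*(W-V)) = -(2*x-1)*(x-b)*R'"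
    using B S2 unfolding R'_def by algebra
  hence 2: "2*x*(B*(W-V)) = -(x-b)*R'" using nz by algebra
  have "2*x*(x+1)*(2*x+1)*(A*X+D*Y) = z*(x*(x+b+1)*X + b*Y)"
    using A D by algebra
  also have "x*(x+b+1)*X + b*Y = (x+1)*((b-x)*Y)"
    using pX by algebra
  finally have "2*x*(2*x+1)*(A*X+D*Y) = z*((b-x)*Y)"
    using nz by algebra
  moreover have "2*x*(2*x+1)*(A+D) = z*(x+b)"
    using A D nz by algebra
  ultimately have 1: "2*x*(2*x+1)*(A*(X-P)+D*(Y-P)) = (b-x)*(z*(Y-P)) - 2*x*z*P"
    by algebra
  have 3: "2*x*(2*x+1)*((C+B)*(V-P)) = ((2*x+1)*(x^2+a*c+a*d+c*d) - z)*(-2*x*P)"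
    using C pV by algebra
  have S1': "z*(Y-P) = -(2*x+1)*R" using S1 unfolding R_def .
  have "2*x*(2*x+1)*(A*(X-P) + D*(Y-P) + C*(V-P) + B*(W-P)) =
        2*x*(2*x+1)*(A*(X-P)+D*(Y-P)) + 2*x*(2*x+1)*((C+B)*(V-P)) + (2*x+1)*(2*x*(B*(W-V)))"
    by algebra
  also have "\<dots> = (2*x+1)*((x-b)*(R - R') - 2*x*(x^2+a*c+a*d+c*d)*P)"
    unfolding 1 2 3 S1' by algebra
  also have "(x-b)*(R - R') - 2*x*(x^2+a*c+a*d+c*d)*P = 2*x*(n*(n+s)*P)"
    using pV unfolding R_def R'_def by algebra
  finally show ?thesis using nz by simp
qed

context alternating_recurrence
begin

lemma difference_equation:
  fixes A B C D x :: complex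
  defines "z \<equiv> (\<lambda>x. (x+a)*(x+c)*(x+d))"
  assumes A: "2*(x+1)*(2*x+1)*A = z x*(x+b+1)"
    and D: "2*x*(x+1)*(2*x+1)*D = z x*b"
    and B: "2*x*(2*x-1)*B = -(x-b)*z (-x)"
    and C: "2*x*(2*x+1)*(C+B) = (x-b)*(2*x+1)*(x^2+a*c+a*d+c*d) - (x-b)*z x"
    and x: "x \<noteq> 0" "x+1 \<noteq> 0" "2*x+1 \<noteq> 0" "2*x-1 \<noteq> 0"
  shows "A*(f N (x+1) - f N x) + D*(f N (-x-1) - f N x) + C*(f N (-x) - f N x) + B*(f N (x-1) - f N x)
    = of_nat (N div 2) * (of_nat (N div 2) + s - (if even N then 1 else 0)) * f N x"
proof (cases "even N")
  case True
  then obtain n where N: "N = 2*n" by blast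
  have "A*(f N (-x-1) - f N x) + D*(f N (-x-1) - f N x) + B*(f N (x-1) - f N x)
          = of_nat n*(of_nat n+s-1)*f N x"
    unfolding N
  proof (rule difference_equation_even[OF structure_relation(1) _ parity(2) _ _ _ x])
    show "z (-x) * (f (2*n) (x-1) - f (2*n) x) = (2*(-x)+1) *
      ((of_nat n+s-1)*(of_nat n+b-(-x)) * f (2*n) x + (2 * of_nat n+s-1) * f (Suc (2*n)) (-x))"
      using structure_relation(1)[of "-x" n] parity(1)[of n x] by (simp add: z_def)
  qed (use A B D in \<open>simp_all add: z_def\<close>)
  moreover have "f N (x+1) = f N (-x-1)" "f N (-x) = f N x"
    unfolding N using parity(1)[of n "x+1"] parity(1)[of n x] by simp_all
  ultimately show ?thesis by (simp add: N)
next
  case False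
  then obtain n where N: "N = Suc (2*n)" by (metis oddE Suc_eq_plus1)
  have "A*(f N (x+1) - f N x) + D*(f N (-x-1) - f N x) + C*(f N (-x) - f N x) + B*(f N (x-1) - f N x)
          = of_nat n*(of_nat n+s)*f N x"
    unfolding N
  proof (rule difference_equation_odd[OF structure_relation(2) _ parity(2) _ _ _ _ _ x])
    show "z (-x) * (f (Suc (2*n)) (x-1) - f (Suc (2*n)) (-x)) = -(2*(-x)+1) *
      (((-x)^2+a*c+a*d+c*d - of_nat n*(-x+b) + of_nat n*(of_nat n+s)) * f (Suc (2*n)) (-x)
       + (2 * of_nat n+s) * f (Suc (Suc (2*n))) x)"
      using structure_relation(2)[of "-x" n] parity(1)[of "Suc n" x] by (simp add: z_def)
    show "(x+1-b) * f (Suc (2*n)) (-x-1) = -(x+1+b) * f (Suc (2*n)) (x+1)"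
      using parity(2)[of "x+1" n] by simp
  qed (use A B C D in \<open>simp_all add: z_def\<close>)
  thus ?thesis by (simp add: N)
qed

end

section \<open>The coefficients of the difference operator\<close>

lemma diff_coeffs_cleared:
  fixes \<rho>1 \<rho>2 r1 r2 x :: complex
  defines "a \<equiv> \<rho>1+1" and "c \<equiv> 1/2-r1" and "d \<equiv> 1/2-r2"
  defines "z \<equiv> (\<lambda>x. (x+a)*(x+c)*(x+d))"
  assumes x: "x \<noteq> 0" "x+1 \<noteq> 0" "2*x+1 \<noteq> 0" "2*x-1 \<noteq> 0"
  shows "2*(x+1)*(2*x+1)*diff_A \<rho>1 \<rho>2 r1 r2 x = z x*(x+\<rho>2+1)"
    and "2*x*(x+1)*(2*x+1)*diff_D \<rho>1 \<rho>2 r1 r2 x = z x*\<rho>2"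
    and "2*x*(2*x-1)*diff_B \<rho>1 \<rho>2 r1 r2 x = -(x-\<rho>2)*z (-x)"
    and "2*x*(2*x+1)*(diff_C \<rho>1 \<rho>2 r1 r2 x + diff_B \<rho>1 \<rho>2 r1 r2 x) =
           (x-\<rho>2)*(2*x+1)*(x^2+a*c+a*d+c*d) - (x-\<rho>2)*z x"
proof -
  have r: "r1 = 1/2-c" "r2 = 1/2-d" "\<rho>1 = a-1" by (simp_all add: a_def c_def d_def)
  have om: "bi_omega \<rho>1 r1 r2 = 4*(a*c+a*d+c*d)"
    unfolding bi_omega_def r by (simp add: algebra_simps)
  have *: "2*x-2*r1+1 = 2*(x+c)" "2*x-2*r2+1 = 2*(x+d)" "2*x+2*r1-1 = -2*(-x+c)" "2*x+2*r2-1 = -2*(-x+d)"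
    "x+\<rho>1+1 = x+a" "x-\<rho>1-1 = -(-x+a)"
    unfolding r by (simp_all add: algebra_simps)
  show "2*(x+1)*(2*x+1)*diff_A \<rho>1 \<rho>2 r1 r2 x = z x*(x+\<rho>2+1)"
    unfolding diff_coeff_eqs(1)[OF x(2,3)] * z_def using x(2,3)
    by (simp add: add_ac del: distrib_left_numeral)
  show "2*x*(x+1)*(2*x+1)*diff_D \<rho>1 \<rho>2 r1 r2 x = z x*\<rho>2"
    unfolding diff_coeff_eqs(4)[OF x(1,2,3)] * z_def using x(1-3)
    by (simp del: distrib_left_numeral)
  show "2*x*(2*x-1)*diff_B \<rho>1 \<rho>2 r1 r2 x = -(x-\<rho>2)*z (-x)"
    unfolding diff_coeff_eqs(2)[OF x(1,4)] * z_def using x(1,4)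
    by (simp add: divide_simps del: distrib_left_numeral) algebra
  show "2*x*(2*x+1)*(diff_C \<rho>1 \<rho>2 r1 r2 x + diff_B \<rho>1 \<rho>2 r1 r2 x) =
           (x-\<rho>2)*(2*x+1)*(x^2+a*c+a*d+c*d) - (x-\<rho>2)*z x"
    unfolding diff_coeff_eqs(3)[OF x(1,3,4)] om * z_def using x(1,3)
    by (simp add: divide_simps del: distrib_left_numeral) algebra
qed

lemma isCont_remove_sings:
  assumes "f meromorphic_on UNIV" "\<not> is_pole (remove_sings f) x"
  shows "isCont (remove_sings f) x"
  using assms by (intro analytic_at_imp_isCont
      nicely_meromorphic_on_imp_analytic_at[OF remove_sings_nicely_meromorphic]) auto

lemma isCont_diff_coeffs:
  shows "\<not> is_pole (diff_A \<rho>1 \<rho>2 r1 r2) x \<Longrightarrow> isCont (diff_A \<rho>1 \<rho>2 r1 r2) x"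
    and "\<not> is_pole (diff_B \<rho>1 \<rho>2 r1 r2) x \<Longrightarrow> isCont (diff_B \<rho>1 \<rho>2 r1 r2) x"
    and "\<not> is_pole (diff_C \<rho>1 \<rho>2 r1 r2) x \<Longrightarrow> isCont (diff_C \<rho>1 \<rho>2 r1 r2) x"
    and "\<not> is_pole (diff_D \<rho>1 \<rho>2 r1 r2) x \<Longrightarrow> isCont (diff_D \<rho>1 \<rho>2 r1 r2) x"
proof -
  have B: "diff_B \<rho>1 \<rho>2 r1 r2 meromorphic_on UNIV"
    unfolding diff_B_def by (intro meromorphic_intros)
  show "\<not> is_pole (diff_A \<rho>1 \<rho>2 r1 r2) x \<Longrightarrow> isCont (diff_A \<rho>1 \<rho>2 r1 r2) x"
    unfolding diff_A_def by (erule isCont_remove_sings[rotated]) (intro meromorphic_intros)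
  show "\<not> is_pole (diff_B \<rho>1 \<rho>2 r1 r2) x \<Longrightarrow> isCont (diff_B \<rho>1 \<rho>2 r1 r2) x"
    unfolding diff_B_def by (erule isCont_remove_sings[rotated]) (intro meromorphic_intros)
  show "\<not> is_pole (diff_C \<rho>1 \<rho>2 r1 r2) x \<Longrightarrow> isCont (diff_C \<rho>1 \<rho>2 r1 r2) x"
    unfolding diff_C_def by (erule isCont_remove_sings[rotated]) (intro meromorphic_intros B)
  show "\<not> is_pole (diff_D \<rho>1 \<rho>2 r1 r2) x \<Longrightarrow> isCont (diff_D \<rho>1 \<rho>2 r1 r2) x"
    unfolding diff_D_def by (erule isCont_remove_sings[rotated]) (intro meromorphic_intros)
qed

text \<open>
  Away from the zeros of the denominators the coefficients are given by their formulas. The remaining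
  points are isolated, and at those of them that are not poles both sides are continuous.
\<close>

lemma CBI_difference_equation:
  fixes \<rho>1 \<rho>2 r1 r2 :: complex and n :: nat
  defines "f \<equiv> poly (CBI \<rho>1 \<rho>2 r1 r2 n)"
  assumes g: "\<And>j::nat. of_nat j + bi_g \<rho>1 \<rho>2 r1 r2 + 1 \<noteq> 0"
    and poles: "\<not> is_pole (diff_A \<rho>1 \<rho>2 r1 r2) x" "\<not> is_pole (diff_B \<rho>1 \<rho>2 r1 r2) x"
      "\<not> is_pole (diff_C \<rho>1 \<rho>2 r1 r2) x" "\<not> is_pole (diff_D \<rho>1 \<rho>2 r1 r2) x"
  shows "diff_A \<rho>1 \<rho>2 r1 r2 x * (f (x+1) - f x) + diff_D \<rho>1 \<rho>2 r1 r2 x * (f (-x-1) - f x)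
       + diff_C \<rho>1 \<rho>2 r1 r2 x * (f (-x) - f x) + diff_B \<rho>1 \<rho>2 r1 r2 x * (f (x-1) - f x)
       = bi_Lambda0 \<rho>1 \<rho>2 r1 r2 n * f x"
proof -
  interpret alternating_recurrence "\<rho>1+1" \<rho>2 "1/2-r1" "1/2-r2" "bi_g \<rho>1 \<rho>2 r1 r2 + 2"
    "\<lambda>n. bi_A \<rho>1 \<rho>2 r1 r2 n * bi_C \<rho>1 \<rho>2 r1 r2 n" "\<lambda>n. poly (CBI \<rho>1 \<rho>2 r1 r2 n)"
    by (rule CBI_alternating_recurrence[OF g]) (simp_all add: bi_g_def)
  have L: "of_nat (n div 2) * (of_nat (n div 2) + (bi_g \<rho>1 \<rho>2 r1 r2 + 2) - (if even n then 1 else 0))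
      = bi_Lambda0 \<rho>1 \<rho>2 r1 r2 n"
    by (simp add: bi_Lambda0_def Let_def algebra_simps power2_eq_square)
  define F where "F = (\<lambda>x. diff_A \<rho>1 \<rho>2 r1 r2 x * (f (x+1) - f x) + diff_D \<rho>1 \<rho>2 r1 r2 x * (f (-x-1) - f x)
       + diff_C \<rho>1 \<rho>2 r1 r2 x * (f (-x) - f x) + diff_B \<rho>1 \<rho>2 r1 r2 x * (f (x-1) - f x))"
  have generic: "F w = bi_Lambda0 \<rho>1 \<rho>2 r1 r2 n * f w"
    if "w \<noteq> 0" "w \<noteq> -1" "w \<noteq> -1/2" "w \<noteq> 1/2" for w
  proof -
    have w: "w \<noteq> 0" "w+1 \<noteq> 0" "2*w+1 \<noteq> 0" "2*w-1 \<noteq> 0"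
    proof -
      have eqs: "w+1 = w-(-1)" "2*w+1 = 2*(w-(-1/2))" "2*w-1 = 2*(w-1/2)" by simp_all
      show "w \<noteq> 0" "w+1 \<noteq> 0" "2*w+1 \<noteq> 0" "2*w-1 \<noteq> 0"
        unfolding eqs mult_eq_0_iff right_minus_eq using that by simp_all
    qed
    show ?thesis
      unfolding F_def f_def using difference_equation[OF diff_coeffs_cleared[OF w] w, of n] unfolding L .
  qed
  have "isCont F x"
    unfolding F_def f_def by (intro continuous_intros isCont_diff_coeffs poles)
  hence "F \<midarrow>x\<rightarrow> F x" by (simp add: isCont_def)
  moreover have "F \<midarrow>x\<rightarrow> bi_Lambda0 \<rho>1 \<rho>2 r1 r2 n * f x"
  proof (rule Lim_transform_eventually)
    show "\<forall>\<^sub>F w in at x. bi_Lambda0 \<rho>1 \<rho>2 r1 r2 n * f w = F w"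
      using eventually_neq_at_within[of 0 x UNIV] eventually_neq_at_within[of "-1" x UNIV]
        eventually_neq_at_within[of "-1/2" x UNIV] eventually_neq_at_within[of "1/2" x UNIV]
      by eventually_elim (simp add: generic)
    show "(\<lambda>w. bi_Lambda0 \<rho>1 \<rho>2 r1 r2 n * f w) \<midarrow>x\<rightarrow> bi_Lambda0 \<rho>1 \<rho>2 r1 r2 n * f x"
      unfolding f_def by (intro tendsto_intros)
  qed
  ultimately have "F x = bi_Lambda0 \<rho>1 \<rho>2 r1 r2 n * f x"
    by (rule LIM_unique)
  thus ?thesis unfolding F_def .
qed

section \<open>The grid\<close>

text \<open>
  The neighbours of a grid point \<open>x\<close> are \<open>- x\<close> and \<open>- x - 1\<close>, and the next but one are \<open>x \<plusminus> 1\<close>. The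
  parity of \<open>k\<close> decides on which side each of them lies, which is just how the coefficients
  \<open>u, v, t, r\<close> are exchanged.
\<close>

lemma bi_grid_neighbours:
  shows "bi_grid h (k+2) = bi_grid h k + (if even k then 1 else -1)"
    and "bi_grid h (k-2) = bi_grid h k - (if even k then 1 else -1)"
    and "bi_grid h (k+1) = - bi_grid h k - (if even k then 1 else 0)"
    and "bi_grid h (k-1) = - bi_grid h k - (if even k then 0 else 1)"
  by (simp_all add: bi_grid_def power_int_minus_left add_divide_distrib diff_divide_distrib)

theorem mainTheorem3:
  fixes \<rho>1 \<rho>2 r1 r2 :: complex and h :: real and n :: nat and k :: int
  assumes "\<And>j::nat. of_nat j + bi_g \<rho>1 \<rho>2 r1 r2 + 1 \<noteq> 0"
    and "\<not> is_pole (diff_A \<rho>1 \<rho>2 r1 r2) (bi_grid h k)"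
    and "\<not> is_pole (diff_B \<rho>1 \<rho>2 r1 r2) (bi_grid h k)"
    and "\<not> is_pole (diff_C \<rho>1 \<rho>2 r1 r2) (bi_grid h k)"
    and "\<not> is_pole (diff_D \<rho>1 \<rho>2 r1 r2) (bi_grid h k)"
  shows
    "diff_u \<rho>1 \<rho>2 r1 r2 h k * poly (CBI \<rho>1 \<rho>2 r1 r2 n) (bi_grid h (k + 2))
     + diff_v \<rho>1 \<rho>2 r1 r2 h k * poly (CBI \<rho>1 \<rho>2 r1 r2 n) (bi_grid h (k + 1))
     + diff_m \<rho>1 \<rho>2 r1 r2 h k * poly (CBI \<rho>1 \<rho>2 r1 r2 n) (bi_grid h k)
     + diff_t \<rho>1 \<rho>2 r1 r2 h k * poly (CBI \<rho>1 \<rho>2 r1 r2 n) (bi_grid h (k - 1))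
     + diff_r \<rho>1 \<rho>2 r1 r2 h k * poly (CBI \<rho>1 \<rho>2 r1 r2 n) (bi_grid h (k - 2))
     = bi_Lambda0 \<rho>1 \<rho>2 r1 r2 n * poly (CBI \<rho>1 \<rho>2 r1 r2 n) (bi_grid h k)"
proof -
  note eq = CBI_difference_equation[OF assms, of n]
  show ?thesis
    using eq unfolding bi_grid_neighbours diff_m_def diff_u_def diff_v_def diff_t_def diff_r_def
    by (cases "even k") (simp_all add: algebra_simps)
qed

end
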